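(* Let $d,k\ge 1$ and $n\ge 2$. Then $\mathrm{TM}_{\rm fix}(\mathbb{Z}^d,n,k)\cong\mathrm{TM}(\mathbb{Z}^d,n,k)$ as monoids, and $\mathrm{RTM}_{\rm fix}(\mathbb{Z}^d,n,k)\cong\mathrm{RTM}(\mathbb{Z}^d,n,k)$ as groups.
   Context: Let $\Sigma=\{0,\dots,n-1\}$, $Q=\{1,\dots,k\}$, and let $\mathbb{Z}^d$ act on $\Sigma^{\mathbb{Z}^d}$ by $(\sigma^{v}(x))_{u}=x_{u-v}$. In both models below, a local rule is a function $f:\Sigma^{F_{\rm in}}\times Q\to\Sigma^{F_{\rm out}}\times Q\times\mathbb{Z}^d$ with $F_{\rm in},F_{\rm out}\subset\mathbb{Z}^d$ finite. Moving head model: a moving head $(\mathbb{Z}^d,n,k)$-Turing machine is a map $T:\Sigma^{\mathbb{Z}^d}\times Q\times\mathbb{Z}^d\to\Sigma^{\mathbb{Z}^d}\times Q\times\mathbb{Z}^d$ such that for some local rule $f$: $T(x,q,v)=(\tilde x,\tilde q,v+\tilde u)$, where $(\tilde p,\tilde q,\tilde u)=f(\sigma^{-v}(x)|_{F_{\rm in}},q)$, $\tilde x_{u}=\tilde p_{u-v}$ if $u-v\in F_{\rm out}$ and $\tilde x_u=x_u$ otherwise. $\mathrm{TM}(\mathbb{Z}^d,n,k)$ is the monoid of these maps under composition and $\mathrm{RTM}(\mathbb{Z}^d,n,k)$ is the group of those having a two-sided inverse in $\mathrm{TM}(\mathbb{Z}^d,n,k)$. Moving tape model: a moving tape $(\mathbb{Z}^d,n,k)$-Turing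 machine is a map $T:\Sigma^{\mathbb{Z}^d}\times Q\to\Sigma^{\mathbb{Z}^d}\times Q$ such that for some local rule $f$: if $f(x|_{F_{\rm in}},q)=(p,q',v)$ then $T(x,q)=(\sigma^{-v}(y),q')$, where $y_u=p_u$ for $u\in F_{\rm out}$ and $y_u=x_u$ otherwise. $\mathrm{TM}_{\rm fix}(\mathbb{Z}^d,n,k)$ is the monoid of these maps under composition and $\mathrm{RTM}_{\rm fix}(\mathbb{Z}^d,n,k)$ is the group of those having a two-sided inverse in $\mathrm{TM}_{\rm fix}(\mathbb{Z}^d,n,k)$. *)

theory Defs
  imports "HOL-Algebra.Group" "HOL-Analysis.Finite_Cartesian_Product"
begin

text \<open>The group \<open>\<int>\<^sup>d\<close> is the type \<open>int ^ 'd\<close>, with \<open>d = CARD('d)\<close>. The alphabet is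
  \<open>{..<n}\<close> and the set of states is \<open>{1..k}\<close>. Patterns with finite support \<open>F\<close> are the elements of
  \<open>F \<rightarrow>\<^sub>E {..<n}\<close>.\<close>

type_synonym 'd config = "(int ^ 'd) \<Rightarrow> nat"

definition configs :: "nat \<Rightarrow> ('d::finite) config set" where
  "configs n = (UNIV \<rightarrow> {..<n})"

definition shift :: "(int ^ 'd) \<Rightarrow> ('d::finite) config \<Rightarrow> 'd config" where
  "shift v x = (\<lambda>u. x (u - v))"

type_synonym 'd rule = "'d config \<times> nat \<Rightarrow> 'd config \<times> nat \<times> (int ^ 'd)"

definition local_rule ::
    "nat \<Rightarrow> nat \<Rightarrow> (int ^ 'd) set \<Rightarrow> (int ^ 'd) set \<Rightarrow> ('d::finite) rule \<Rightarrow> bool" where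
  "local_rule n k Fin Fout f \<longleftrightarrow> finite Fin \<and> finite Fout \<and>
     f \<in> (Fin \<rightarrow>\<^sub>E {..<n}) \<times> {1..k} \<rightarrow> (Fout \<rightarrow>\<^sub>E {..<n}) \<times> {1..k} \<times> UNIV"

definition head_map ::
    "(int ^ 'd) set \<Rightarrow> (int ^ 'd) set \<Rightarrow> ('d::finite) rule \<Rightarrow>
     'd config \<times> nat \<times> (int ^ 'd) \<Rightarrow> 'd config \<times> nat \<times> (int ^ 'd)" where
  "head_map Fin Fout f = (\<lambda>(x, q, v).
     let (p, q', u') = f (restrict (shift (- v) x) Fin, q)
     in (\<lambda>u. if u - v \<in> Fout then p (u - v) else x u, q', v + u'))"

definition tape_map ::
    "(int ^ 'd) set \<Rightarrow> (int ^ 'd) set \<Rightarrow> ('d::finite) rule \<Rightarrow>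
     'd config \<times> nat \<Rightarrow> 'd config \<times> nat" where
  "tape_map Fin Fout f = (\<lambda>(x, q).
     let (p, q', v) = f (restrict x Fin, q)
     in (shift (- v) (\<lambda>u. if u \<in> Fout then p u else x u), q'))"

definition head_space :: "nat \<Rightarrow> nat \<Rightarrow> (('d::finite) config \<times> nat \<times> (int ^ 'd)) set" where
  "head_space n k = configs n \<times> {1..k} \<times> UNIV"

definition tape_space :: "nat \<Rightarrow> nat \<Rightarrow> (('d::finite) config \<times> nat) set" where
  "tape_space n k = configs n \<times> {1..k}"

text \<open>A map on \<open>head_space n k\<close> or \<open>tape_space n k\<close> is represented by its extensional version
  (value \<open>undefined\<close> outside that set), so that equality of HOL functions is equality of maps.\<close>

definition TM :: "('d::finite) itself \<Rightarrow> nat \<Rightarrow> nat \<Rightarrow>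
    ('d config \<times> nat \<times> (int ^ 'd) \<Rightarrow> 'd config \<times> nat \<times> (int ^ 'd)) monoid" where
  "TM _ n k =
    \<lparr>carrier = {T. \<exists>Fin Fout f. local_rule n k Fin Fout f \<and>
                     T = restrict (head_map Fin Fout f) (head_space n k)},
     mult = compose (head_space n k),
     one = (\<lambda>z\<in>head_space n k. z)\<rparr>"

definition TM_fix :: "('d::finite) itself \<Rightarrow> nat \<Rightarrow> nat \<Rightarrow>
    ('d config \<times> nat \<Rightarrow> 'd config \<times> nat) monoid" where
  "TM_fix _ n k =
    \<lparr>carrier = {T. \<exists>Fin Fout f. local_rule n k Fin Fout f \<and>
                     T = restrict (tape_map Fin Fout f) (tape_space n k)},
     mult = compose (tape_space n k),
     one = (\<lambda>z\<in>tape_space n k. z)\<rparr>"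

definition RTM :: "('d::finite) itself \<Rightarrow> nat \<Rightarrow> nat \<Rightarrow>
    ('d config \<times> nat \<times> (int ^ 'd) \<Rightarrow> 'd config \<times> nat \<times> (int ^ 'd)) monoid" where
  "RTM d n k = units_of (TM d n k)"

definition RTM_fix :: "('d::finite) itself \<Rightarrow> nat \<Rightarrow> nat \<Rightarrow>
    ('d config \<times> nat \<Rightarrow> 'd config \<times> nat) monoid" where
  "RTM_fix d n k = units_of (TM_fix d n k)"


text \<open>The rest of the theory shows that \<open>TM\<close> and \<open>TM_fix\<close> are monoids (so that \<open>RTM\<close> and \<open>RTM_fix\<close>
  are groups). Both kinds of machines are determined by maps of the following form, which describe
  one step of a machine whose head is at the origin.\<close>

definition is_local ::
    "nat \<Rightarrow> nat \<Rightarrow> (int ^ 'd) set \<Rightarrow> ('d::finite) rule \<Rightarrow> bool" where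
  "is_local n k F G \<longleftrightarrow> finite F \<and>
     (\<forall>x\<in>configs n. \<forall>q\<in>{1..k}. fst (G (x, q)) \<in> configs n \<and> fst (snd (G (x, q))) \<in> {1..k} \<and>
        (\<forall>u. u \<notin> F \<longrightarrow> fst (G (x, q)) u = x u)) \<and>
     (\<forall>x\<in>configs n. \<forall>x'\<in>configs n. \<forall>q\<in>{1..k}. (\<forall>u\<in>F. x u = x' u) \<longrightarrow>
        snd (G (x, q)) = snd (G (x', q)) \<and> (\<forall>u\<in>F. fst (G (x, q)) u = fst (G (x', q)) u))"

definition step ::
    "(int ^ 'd) set \<Rightarrow> (int ^ 'd) set \<Rightarrow> ('d::finite) rule \<Rightarrow> 'd rule" where
  "step Fin Fout f = (\<lambda>(x, q).
     let (p, q', v) = f (restrict x Fin, q)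
     in (\<lambda>u. if u \<in> Fout then p u else x u, q', v))"

definition head_lift ::
    "('d::finite) rule \<Rightarrow> 'd config \<times> nat \<times> (int ^ 'd) \<Rightarrow> 'd config \<times> nat \<times> (int ^ 'd)" where
  "head_lift G = (\<lambda>(x, q, v). let (y, q', u) = G (shift (- v) x, q) in (shift v y, q', v + u))"

definition tape_lift :: "('d::finite) rule \<Rightarrow> 'd config \<times> nat \<Rightarrow> 'd config \<times> nat" where
  "tape_lift G = (\<lambda>(x, q). let (y, q', u) = G (x, q) in (shift (- u) y, q'))"

definition step_comp :: "('d::finite) rule \<Rightarrow> 'd rule \<Rightarrow> 'd rule" where
  "step_comp G H = (\<lambda>(x, q).
     let (y, q', u) = H (x, q); (z, q'', w) = G (shift (- u) y, q')
     in (shift u z, q'', u + w))"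

lemma shift_shift [simp]: "shift u (shift v x) = shift (u + v) x"
  by (simp add: shift_def fun_eq_iff algebra_simps)

lemma shift_0 [simp]: "shift 0 x = x"
  by (simp add: shift_def)

lemma shift_configs [simp]: "shift v x \<in> configs n \<longleftrightarrow> x \<in> configs n"
proof
  assume "shift v x \<in> configs n"
  then have "x (u + v - v) < n" for u
    unfolding configs_def shift_def Pi_iff by blast
  then show "x \<in> configs n" by (simp add: configs_def)
qed (simp add: configs_def shift_def Pi_iff)

lemma head_map_eq: "head_map Fin Fout f = head_lift (step Fin Fout f)"
proof
  fix z
  show "head_map Fin Fout f z = head_lift (step Fin Fout f) z"
  proof (cases z)
    case (fields x q v)
    obtain p q' u where "f (restrict (shift (- v) x) Fin, q) = (p, q', u)" by (metis surj_pair)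
    then show ?thesis
      by (simp add: fields head_map_def head_lift_def step_def)
        (simp add: shift_def fun_eq_iff)
  qed
qed

lemma tape_map_eq: "tape_map Fin Fout f = tape_lift (step Fin Fout f)"
  by (simp add: tape_map_def tape_lift_def step_def fun_eq_iff split: prod.splits)

lemma is_localD:
  assumes "is_local n k F G" "x \<in> configs n" "q \<in> {1..k}" "G (x, q) = (y, q', v)"
  shows "y \<in> configs n" "q' \<in> {1..k}" "\<And>u. u \<notin> F \<Longrightarrow> y u = x u"
  using assms unfolding is_local_def by (metis fst_conv snd_conv)+

lemma is_local_cong:
  assumes "is_local n k F G" "x \<in> configs n" "x' \<in> configs n" "q \<in> {1..k}"
    and "\<And>u. u \<in> F \<Longrightarrow> x u = x' u"
    and "G (x, q) = (y, q', v)" "G (x', q) = (y', q'', v')"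
  shows "q' = q''" "v = v'" "\<And>u. x u = x' u \<Longrightarrow> y u = y' u"
proof -
  have *: "snd (G (x, q)) = snd (G (x', q))" "\<forall>u\<in>F. fst (G (x, q)) u = fst (G (x', q)) u"
    using assms(1-5) unfolding is_local_def by blast+
  then show "q' = q''" "v = v'" using assms(6,7) by auto
  show "y u = y' u" if "x u = x' u" for u
    using * that is_localD(3)[OF assms(1,2,4,6)] is_localD(3)[OF assms(1,3,4,7)] assms(6,7)
    by (cases "u \<in> F") auto
qed

lemma is_localI:
  fixes G :: "('d::finite) rule"
  assumes "finite F"
    and "\<And>x q y q' v. x \<in> configs n \<Longrightarrow> q \<in> {1..k} \<Longrightarrow> G (x, q) = (y, q', v) \<Longrightarrow>
           y \<in> configs n \<and> q' \<in> {1..k} \<and> (\<forall>u. u \<notin> F \<longrightarrow> y u = x u)"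
    and "\<And>x x' q y q' v y' q'' v'. x \<in> configs n \<Longrightarrow> x' \<in> configs n \<Longrightarrow> q \<in> {1..k} \<Longrightarrow>
           (\<And>u. u \<in> F \<Longrightarrow> x u = x' u) \<Longrightarrow> G (x, q) = (y, q', v) \<Longrightarrow> G (x', q) = (y', q'', v') \<Longrightarrow>
           q' = q'' \<and> v = v' \<and> (\<forall>u\<in>F. y u = y' u)"
  shows "is_local n k F G"
proof -
  have eq: "G z = (fst (G z), fst (snd (G z)), snd (snd (G z)))" for z by simp
  show ?thesis
    unfolding is_local_def
  proof (intro conjI ballI impI)
    fix x :: "'d config" and q assume "x \<in> configs n" "q \<in> {1..k}"
    note * = assms(2)[OF this eq]
    show "fst (G (x, q)) \<in> configs n" "fst (snd (G (x, q))) \<in> {1..k}"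
      "\<forall>u. u \<notin> F \<longrightarrow> fst (G (x, q)) u = x u"
      using * by blast+
  next
    fix x x' :: "'d config" and q
    assume x: "x \<in> configs n" "x' \<in> configs n" "q \<in> {1..k}" and e: "\<forall>u\<in>F. x u = x' u"
    have *: "fst (snd (G (x, q))) = fst (snd (G (x', q))) \<and>
        snd (snd (G (x, q))) = snd (snd (G (x', q))) \<and>
        (\<forall>u\<in>F. fst (G (x, q)) u = fst (G (x', q)) u)"
      by (rule assms(3)[OF x _ eq eq]) (rule bspec[OF e])
    show "snd (G (x, q)) = snd (G (x', q))" using * by (simp add: prod_eq_iff)
    show "fst (G (x, q)) u = fst (G (x', q)) u" if "u \<in> F" for u using * that by blast
  qed (rule assms(1))
qed

lemma is_local_step:
  assumes f: "local_rule n k Fin Fout f"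
  shows "is_local n k (Fin \<union> Fout) (step Fin Fout f)"
proof (rule is_localI)
  show "finite (Fin \<union> Fout)" using f by (simp add: local_rule_def)
next
  fix x q y q' v
  assume x: "x \<in> configs n" and q: "q \<in> {1..k}" and s: "step Fin Fout f (x, q) = (y, q', v)"
  obtain p where p: "f (restrict x Fin, q) = (p, q', v)"
    and y: "y = (\<lambda>u. if u \<in> Fout then p u else x u)"
    using s by (auto simp: step_def split: prod.splits)
  have "(restrict x Fin, q) \<in> (Fin \<rightarrow>\<^sub>E {..<n}) \<times> {1..k}"
    using x q by (auto simp: configs_def)
  then have "f (restrict x Fin, q) \<in> (Fout \<rightarrow>\<^sub>E {..<n}) \<times> {1..k} \<times> UNIV"
    using f unfolding local_rule_def by blast
  then show "y \<in> configs n \<and> q' \<in> {1..k} \<and> (\<forall>u. u \<notin> Fin \<union> Fout \<longrightarrow> y u = x u)"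
    using x p by (auto simp: y configs_def PiE_iff)
next
  fix x x' q y q' v y' q'' v'
  assume e: "\<And>u. u \<in> Fin \<union> Fout \<Longrightarrow> x u = x' u"
    and s: "step Fin Fout f (x, q) = (y, q', v)" "step Fin Fout f (x', q) = (y', q'', v')"
  have "restrict x Fin = restrict x' Fin" using e by (auto simp: restrict_def)
  then show "q' = q'' \<and> v = v' \<and> (\<forall>u\<in>Fin \<union> Fout. y u = y' u)"
    using s e by (auto simp: step_def split: prod.splits)
qed

lemma is_local_imp_step:
  fixes G :: "('d::finite) rule"
  assumes G: "is_local n k F G" and n: "0 < n"
  obtains f where "local_rule n k F F f"
    and "\<And>x q. x \<in> configs n \<Longrightarrow> q \<in> {1..k} \<Longrightarrow> step F F f (x, q) = G (x, q)"
proof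
  define e where "e r = (\<lambda>u. if u \<in> F then r u else (0::nat))" for r
  define f where "f = (\<lambda>(r, q). let (y, q', v) = G (e r, q) in (restrict y F, q', v))"
  show "local_rule n k F F f"
    unfolding local_rule_def
  proof (intro conjI)
    show "f \<in> (F \<rightarrow>\<^sub>E {..<n}) \<times> {1..k} \<rightarrow> (F \<rightarrow>\<^sub>E {..<n}) \<times> {1..k} \<times> UNIV"
    proof
      fix z assume "z \<in> (F \<rightarrow>\<^sub>E {..<n}) \<times> {1..k}"
      then obtain r q where z: "z = (r, q)" and r: "r \<in> F \<rightarrow>\<^sub>E {..<n}" and q: "q \<in> {1..k}"
        by auto
      obtain y q' v where y: "G (e r, q) = (y, q', v)" by (metis surj_pair)
      have "e r \<in> configs n" using r n by (auto simp: configs_def e_def)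
      from is_localD[OF G this q y]
      show "f z \<in> (F \<rightarrow>\<^sub>E {..<n}) \<times> {1..k} \<times> UNIV"
        by (auto simp: z f_def y configs_def)
    qed
  qed (use G in \<open>auto simp: is_local_def\<close>)
  fix x :: "'d config" and q assume x: "x \<in> configs n" and q: "q \<in> {1..k}"
  obtain y q' v where y: "G (x, q) = (y, q', v)" by (metis surj_pair)
  obtain z q'' w where z: "G (e (restrict x F), q) = (z, q'', w)" by (metis surj_pair)
  have ex: "e (restrict x F) \<in> configs n" using x n by (auto simp: configs_def e_def)
  have eq: "e (restrict x F) u = x u" if "u \<in> F" for u using that by (simp add: e_def)
  show "step F F f (x, q) = G (x, q)"
    using is_local_cong[OF G ex x q eq z y] eq is_localD(3)[OF G x q y]
    by (auto simp: step_def f_def z y)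
qed

lemma is_local_mono:
  assumes G: "is_local n k F G" and F': "F \<subseteq> F'" "finite F'"
  shows "is_local n k F' G"
proof (rule is_localI)
  fix x x' q y q' v y' q'' v'
  assume "x \<in> configs n" "x' \<in> configs n" "q \<in> {1..k}" "\<And>u. u \<in> F' \<Longrightarrow> x u = x' u"
    "G (x, q) = (y, q', v)" "G (x', q) = (y', q'', v')"
  then show "q' = q'' \<and> v = v' \<and> (\<forall>u\<in>F'. y u = y' u)"
    using is_local_cong[OF G, of x x' q y q' v y' q'' v'] F'(1) by blast
next
  fix x q y q' v
  assume "x \<in> configs n" "q \<in> {1..k}" "G (x, q) = (y, q', v)"
  then show "y \<in> configs n \<and> q' \<in> {1..k} \<and> (\<forall>u. u \<notin> F' \<longrightarrow> y u = x u)"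
    using is_localD[OF G, of x q y q' v] F'(1) by blast
qed (rule F'(2))

lemma finite_moves:
  fixes G :: "('d::finite) rule"
  assumes G: "is_local n k F G" and n: "0 < n"
  shows "finite ((\<lambda>z. snd (snd (G z))) ` (configs n \<times> {1..k}))"
proof -
  obtain f where f: "local_rule n k F F f"
    "\<And>x q. x \<in> configs n \<Longrightarrow> q \<in> {1..k} \<Longrightarrow> step F F f (x, q) = G (x, q)"
    using is_local_imp_step[OF G n] by blast
  have "(\<lambda>z. snd (snd (G z))) ` (configs n \<times> {1..k})
      \<subseteq> (\<lambda>z. snd (snd (f z))) ` ((F \<rightarrow>\<^sub>E {..<n}) \<times> {1..k})"
  proof (clarify)
    fix x :: "'d config" and q assume x: "x \<in> configs n" and q: "q \<in> {1..k}"
    have "snd (snd (G (x, q))) = snd (snd (f (restrict x F, q)))"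
      using f(2)[OF x q, symmetric] by (simp add: step_def split: prod.splits)
    moreover have "(restrict x F, q) \<in> (F \<rightarrow>\<^sub>E {..<n}) \<times> {1..k}"
      using x q by (auto simp: configs_def)
    ultimately show "snd (snd (G (x, q))) \<in>
        (\<lambda>z. snd (snd (f z))) ` ((F \<rightarrow>\<^sub>E {..<n}) \<times> {1..k})"
      by (metis image_eqI)
  qed
  moreover have "finite ((F \<rightarrow>\<^sub>E {..<n}) \<times> {1..k})"
    using f(1) by (auto simp: local_rule_def intro!: finite_PiE)
  ultimately show ?thesis by (meson finite_imageI finite_subset)
qed

lemma is_local_comp:
  assumes G: "is_local n k F G" and H: "is_local n k F' H" and n: "0 < n"
  shows "\<exists>E. is_local n k E (step_comp G H)"
proof
  define U where "U = (\<lambda>z. snd (snd (H z))) ` (configs n \<times> {1..k})"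
  define E where "E = F' \<union> (\<Union>u\<in>U. (\<lambda>w. u + w) ` F)"
  have finE: "finite E"
  proof -
    have "finite F" "finite F'" using G H unfolding is_local_def by blast+
    moreover have "finite U" unfolding U_def by (rule finite_moves[OF H n])
    ultimately show ?thesis unfolding E_def by blast
  qed
  have HE: "is_local n k E H"
    by (rule is_local_mono[OF H _ finE]) (simp add: E_def)
  have UI: "u \<in> U" if "x \<in> configs n" "q \<in> {1..k}" "H (x, q) = (y, q', u)" for x q y q' u
    unfolding U_def using that by (intro image_eqI[of _ _ "(x, q)"]) auto
  show "is_local n k E (step_comp G H)"
  proof (rule is_localI)
    fix x q y r v
    assume x: "x \<in> configs n" and q: "q \<in> {1..k}" and s: "step_comp G H (x, q) = (y, r, v)"
    obtain y1 q1 u where h: "H (x, q) = (y1, q1, u)" by (metis surj_pair)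
    obtain z q2 w where g: "G (shift (- u) y1, q1) = (z, q2, w)" by (metis surj_pair)
    have eqs: "y = shift u z" "r = q2" using s h g by (auto simp: step_comp_def)
    note 1 = is_localD[OF HE x q h]
    have c: "shift (- u) y1 \<in> configs n" using 1 by simp
    note 2 = is_localD[OF G c 1(2) g]
    have "y a = x a" if "a \<notin> E" for a
    proof -
      have "a - u \<notin> F"
        using that UI[OF x q h] by (force simp: E_def image_iff algebra_simps)
      then have "z (a - u) = shift (- u) y1 (a - u)" by (rule 2(3))
      then show ?thesis using 1(3)[OF that] by (simp add: eqs shift_def)
    qed
    then show "y \<in> configs n \<and> r \<in> {1..k} \<and> (\<forall>a. a \<notin> E \<longrightarrow> y a = x a)"
      using 2 by (simp add: eqs)
  next
    fix x x' q y r v y' r' v'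
    assume x: "x \<in> configs n" and x': "x' \<in> configs n" and q: "q \<in> {1..k}"
      and e: "\<And>u. u \<in> E \<Longrightarrow> x u = x' u"
      and s: "step_comp G H (x, q) = (y, r, v)" and s': "step_comp G H (x', q) = (y', r', v')"
    obtain y1 q1 u where h: "H (x, q) = (y1, q1, u)" by (metis surj_pair)
    obtain z q2 w where g: "G (shift (- u) y1, q1) = (z, q2, w)" by (metis surj_pair)
    obtain y1' q1' u' where h': "H (x', q) = (y1', q1', u')" by (metis surj_pair)
    have *: "q1' = q1" "u' = u" "\<And>a. x a = x' a \<Longrightarrow> y1 a = y1' a"
      using is_local_cong[OF HE x x' q e h h'] by auto
    obtain z' q2' w' where g': "G (shift (- u) y1', q1) = (z', q2', w')" by (metis surj_pair)
    have c: "shift (- u) y1 \<in> configs n" "shift (- u) y1' \<in> configs n" "q1 \<in> {1..k}"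
      using is_localD[OF HE x q h] is_localD[OF HE x' q h'] by auto
    have ee: "shift (- u) y1 a = shift (- u) y1' a" if "a \<in> F" for a
    proof -
      have "a + u \<in> E" using that UI[OF x q h] by (force simp: E_def algebra_simps)
      then show ?thesis using *(3) e by (simp add: shift_def)
    qed
    note ** = is_local_cong[OF G c ee g g']
    have eqs: "y = shift u z" "r = q2" "v = u + w" "y' = shift u z'" "r' = q2'" "v' = u + w'"
      using s s' h g h' g' * by (auto simp: step_comp_def)
    have "y a = y' a" if "a \<in> E" for a
      using **(3)[of "a - u"] *(3)[of a] e[OF that] by (simp add: eqs shift_def)
    then show "r = r' \<and> v = v' \<and> (\<forall>a\<in>E. y a = y' a)" using ** by (simp add: eqs)
  qed (rule finE)
qed

lemma head_lift_in:
  assumes "is_local n k F G" "z \<in> head_space n k" shows "head_lift G z \<in> head_space n k"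
proof (cases z)
  case (fields x q v)
  obtain y q' u where g: "G (shift (- v) x, q) = (y, q', u)" by (metis surj_pair)
  have "shift (- v) x \<in> configs n" "q \<in> {1..k}"
    using assms(2) by (auto simp: fields head_space_def)
  from is_localD(1,2)[OF assms(1) this g] g show ?thesis
    by (simp add: fields head_lift_def head_space_def)
qed

lemma tape_lift_in:
  assumes "is_local n k F G" "z \<in> tape_space n k" shows "tape_lift G z \<in> tape_space n k"
proof (cases z)
  case (Pair x q)
  obtain y q' u where g: "G (x, q) = (y, q', u)" by (metis surj_pair)
  have "x \<in> configs n" "q \<in> {1..k}"
    using assms(2) by (auto simp: Pair tape_space_def)
  from is_localD(1,2)[OF assms(1) this g] g show ?thesis
    by (simp add: Pair tape_lift_def tape_space_def)
qed

lemma carrier_TM: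
  assumes "0 < n"
  shows "carrier (TM TYPE('d::finite) n k) =
    {restrict (head_lift G) (head_space n k) | (G :: 'd rule) F. is_local n k F G}"
proof (intro subset_antisym subsetI; clarsimp simp: TM_def head_map_eq)
  fix Fin Fout and f :: "'d rule"
  assume "local_rule n k Fin Fout f"
  then show "\<exists>G. restrict (head_lift (step Fin Fout f)) (head_space n k)
      = restrict (head_lift G) (head_space n k) \<and> (\<exists>F. is_local n k F G)"
    using is_local_step by blast
next
  fix F and G :: "'d rule"
  assume "is_local n k F G"
  then obtain f where f: "local_rule n k F F f"
    "\<And>x q. x \<in> configs n \<Longrightarrow> q \<in> {1..k} \<Longrightarrow> step F F f (x, q) = G (x, q)"
    using is_local_imp_step assms by blast
  have "restrict (head_lift G) (head_space n k) =
      restrict (head_lift (step F F f)) (head_space n k)"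
    by (rule restrict_ext) (auto simp: head_lift_def head_space_def f(2))
  with f(1) show "\<exists>Fin Fout f. local_rule n k Fin Fout f \<and> restrict (head_lift G) (head_space n k) =
      restrict (head_lift (step Fin Fout f)) (head_space n k)" by blast
qed

lemma carrier_TM_fix:
  assumes "0 < n"
  shows "carrier (TM_fix TYPE('d::finite) n k) =
    {restrict (tape_lift G) (tape_space n k) | (G :: 'd rule) F. is_local n k F G}"
proof (intro subset_antisym subsetI; clarsimp simp: TM_fix_def tape_map_eq)
  fix Fin Fout and f :: "'d rule"
  assume "local_rule n k Fin Fout f"
  then show "\<exists>G. restrict (tape_lift (step Fin Fout f)) (tape_space n k)
      = restrict (tape_lift G) (tape_space n k) \<and> (\<exists>F. is_local n k F G)"
    using is_local_step by blast
next
  fix F and G :: "'d rule"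
  assume "is_local n k F G"
  then obtain f where f: "local_rule n k F F f"
    "\<And>x q. x \<in> configs n \<Longrightarrow> q \<in> {1..k} \<Longrightarrow> step F F f (x, q) = G (x, q)"
    using is_local_imp_step assms by blast
  have "restrict (tape_lift G) (tape_space n k) =
      restrict (tape_lift (step F F f)) (tape_space n k)"
    by (rule restrict_ext) (auto simp: tape_lift_def tape_space_def f(2))
  with f(1) show "\<exists>Fin Fout f. local_rule n k Fin Fout f \<and> restrict (tape_lift G) (tape_space n k) =
      restrict (tape_lift (step Fin Fout f)) (tape_space n k)" by blast
qed

lemma head_lift_comp: "head_lift G (head_lift H z) = head_lift (step_comp G H) z"
  by (cases z) (simp add: head_lift_def step_comp_def split: prod.splits)

lemma tape_lift_comp: "tape_lift G (tape_lift H z) = tape_lift (step_comp G H) z"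
  by (cases z) (simp add: tape_lift_def step_comp_def split: prod.splits)

lemma is_local_id: "is_local n k {} (\<lambda>(x, q). (x, q, 0))"
  by (rule is_localI) auto

lemma monoid_TM:
  assumes n: "0 < n" shows "monoid (TM TYPE('d::finite) n k)"
proof
  let ?M = "TM TYPE('d) n k" and ?S = "head_space n k :: ('d config \<times> nat \<times> (int ^ 'd)) set"
  have mult: "S \<otimes>\<^bsub>?M\<^esub> T = compose ?S S T" for S T by (simp add: TM_def)
  have one: "\<one>\<^bsub>?M\<^esub> = (\<lambda>z\<in>?S. z)" by (simp add: TM_def)
  have car: "T \<in> ?S \<rightarrow>\<^sub>E ?S" if "T \<in> carrier ?M" for T
    using that head_lift_in unfolding carrier_TM[OF n] by auto
  show "S \<otimes>\<^bsub>?M\<^esub> T \<in> carrier ?M" if ST: "S \<in> carrier ?M" "T \<in> carrier ?M" for S T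
  proof -
    obtain G F H F' where G: "S = restrict (head_lift G) ?S" "is_local n k F G"
      and H: "T = restrict (head_lift H) ?S" "is_local n k F' H"
      using ST unfolding carrier_TM[OF n] by blast
    have "compose ?S S T = restrict (head_lift (step_comp G H)) ?S"
      unfolding compose_def
      by (rule restrict_ext) (simp add: G H head_lift_in[OF H(2)] head_lift_comp)
    then show ?thesis
      unfolding carrier_TM[OF n] mult using is_local_comp[OF G(2) H(2) n] by blast
  qed
  have "(\<lambda>z\<in>?S. z) = restrict (head_lift (\<lambda>(x, q). (x, q, 0))) ?S"
    by (rule restrict_ext) (auto simp: head_lift_def)
  then show "\<one>\<^bsub>?M\<^esub> \<in> carrier ?M"
    unfolding carrier_TM[OF n] one using is_local_id by blast
  show "S \<otimes>\<^bsub>?M\<^esub> T \<otimes>\<^bsub>?M\<^esub> R = S \<otimes>\<^bsub>?M\<^esub> (T \<otimes>\<^bsub>?M\<^esub> R)" if "R \<in> carrier ?M" for S T R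
    unfolding mult by (rule compose_assoc[symmetric]) (use car[OF that] in auto)
  show "\<one>\<^bsub>?M\<^esub> \<otimes>\<^bsub>?M\<^esub> T = T" if "T \<in> carrier ?M" for T
    unfolding mult one using car[OF that] by (intro Id_compose) (auto simp: PiE_def)
  show "T \<otimes>\<^bsub>?M\<^esub> \<one>\<^bsub>?M\<^esub> = T" if "T \<in> carrier ?M" for T
    unfolding mult one using car[OF that] by (intro compose_Id) (auto simp: PiE_def)
qed

lemma monoid_TM_fix:
  assumes n: "0 < n" shows "monoid (TM_fix TYPE('d::finite) n k)"
proof
  let ?M = "TM_fix TYPE('d) n k" and ?S = "tape_space n k :: ('d config \<times> nat) set"
  have mult: "S \<otimes>\<^bsub>?M\<^esub> T = compose ?S S T" for S T by (simp add: TM_fix_def)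
  have one: "\<one>\<^bsub>?M\<^esub> = (\<lambda>z\<in>?S. z)" by (simp add: TM_fix_def)
  have car: "T \<in> ?S \<rightarrow>\<^sub>E ?S" if "T \<in> carrier ?M" for T
    using that tape_lift_in unfolding carrier_TM_fix[OF n] by auto
  show "S \<otimes>\<^bsub>?M\<^esub> T \<in> carrier ?M" if ST: "S \<in> carrier ?M" "T \<in> carrier ?M" for S T
  proof -
    obtain G F H F' where G: "S = restrict (tape_lift G) ?S" "is_local n k F G"
      and H: "T = restrict (tape_lift H) ?S" "is_local n k F' H"
      using ST unfolding carrier_TM_fix[OF n] by blast
    have "compose ?S S T = restrict (tape_lift (step_comp G H)) ?S"
      unfolding compose_def
      by (rule restrict_ext) (simp add: G H tape_lift_in[OF H(2)] tape_lift_comp)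
    then show ?thesis
      unfolding carrier_TM_fix[OF n] mult using is_local_comp[OF G(2) H(2) n] by blast
  qed
  have "(\<lambda>z\<in>?S. z) = restrict (tape_lift (\<lambda>(x, q). (x, q, 0))) ?S"
    by (rule restrict_ext) (auto simp: tape_lift_def)
  then show "\<one>\<^bsub>?M\<^esub> \<in> carrier ?M"
    unfolding carrier_TM_fix[OF n] one using is_local_id by blast
  show "S \<otimes>\<^bsub>?M\<^esub> T \<otimes>\<^bsub>?M\<^esub> R = S \<otimes>\<^bsub>?M\<^esub> (T \<otimes>\<^bsub>?M\<^esub> R)" if "R \<in> carrier ?M" for S T R
    unfolding mult by (rule compose_assoc[symmetric]) (use car[OF that] in auto)
  show "\<one>\<^bsub>?M\<^esub> \<otimes>\<^bsub>?M\<^esub> T = T" if "T \<in> carrier ?M" for T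
    unfolding mult one using car[OF that] by (intro Id_compose) (auto simp: PiE_def)
  show "T \<otimes>\<^bsub>?M\<^esub> \<one>\<^bsub>?M\<^esub> = T" if "T \<in> carrier ?M" for T
    unfolding mult one using car[OF that] by (intro compose_Id) (auto simp: PiE_def)
qed

lemma group_RTM: "0 < n \<Longrightarrow> group (RTM TYPE('d::finite) n k)"
  unfolding RTM_def by (rule monoid.units_group[OF monoid_TM])

lemma group_RTM_fix: "0 < n \<Longrightarrow> group (RTM_fix TYPE('d::finite) n k)"
  unfolding RTM_fix_def by (rule monoid.units_group[OF monoid_TM_fix])

text \<open>The relation \<open>\<cong>\<close> only asks for a multiplicative bijection, which in monoids preserves the
  unit.\<close>

lemma iso_preserves_one:
  assumes "monoid M" "monoid N" "h \<in> iso M N"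
  shows "h \<one>\<^bsub>M\<^esub> = \<one>\<^bsub>N\<^esub>"
proof -
  interpret M: monoid M by fact
  interpret N: monoid N by fact
  have h: "h \<in> hom M N" and surj: "h ` carrier M = carrier N"
    using assms(3) by (auto simp: iso_def bij_betw_def)
  have "\<one>\<^bsub>N\<^esub> \<in> h ` carrier M" unfolding surj by (rule N.one_closed)
  then obtain e where e: "e \<in> carrier M" "h e = \<one>\<^bsub>N\<^esub>" by (metis imageE)
  have "\<one>\<^bsub>N\<^esub> = h (e \<otimes>\<^bsub>M\<^esub> \<one>\<^bsub>M\<^esub>)" using e by simp
  also have "\<dots> = h e \<otimes>\<^bsub>N\<^esub> h \<one>\<^bsub>M\<^esub>" by (rule hom_mult[OF h e(1) M.one_closed])
  also have "\<dots> = h \<one>\<^bsub>M\<^esub>"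
    unfolding e(2) by (rule N.l_one) (rule hom_in_carrier[OF h M.one_closed])
  finally show ?thesis by (rule sym)
qed

end

theory Submission
  imports Defs
begin

text \<open>One step of a machine, seen from a head at the origin, is a local map \<open>G\<close> that turns a
  configuration and a state into a configuration, a state and a move. The moving head machine of \<open>G\<close>
  is determined by \<open>G\<close> and conversely, because \<open>G\<close> is the restriction of that machine to head
  position \<open>0\<close>. In the moving tape model the move is no longer part of the output: it only shows as
  a translation of the tape. So there is an obvious multiplicative surjection from the first model
  to the second, forgetting the head position by following the head (\<open>tape_of\<close>), and the only
  question is whether it is injective, that is, whether the tape machine still determines the moves.

  It does (\<open>tape_lift_determines_step\<close>), since \<open>G\<close> rewrites only a fixed finite window whereas the
  translation acts on the whole tape. If two local maps agreed as tape machines but made different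
  moves on some input, then changing a single symbol far from the window would change neither
  move, and the translated tapes would differ. This needs infinitely many cells and two symbols.

  An isomorphism of monoids restricts to the groups of units, which gives the statement on
  reversible machines.\<close>

lemma monoid_iso_inv_into:
  assumes "monoid M" "h \<in> iso M N"
  shows "inv_into (carrier M) h \<in> iso N M"
proof -
  interpret M: monoid M by fact
  let ?g = "inv_into (carrier M) h"
  have h: "h \<in> hom M N" and bij: "bij_betw h (carrier M) (carrier N)"
    using assms(2) by (auto simp: iso_def)
  have bij': "bij_betw ?g (carrier N) (carrier M)" by (rule bij_betw_inv_into[OF bij])
  have "?g \<in> hom N M"
  proof (rule homI)
    show mem: "?g b \<in> carrier M" if "b \<in> carrier N" for b
      using bij' that by (auto dest: bij_betwE)
    fix b c assume b: "b \<in> carrier N" and c: "c \<in> carrier N"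
    have "h (?g b \<otimes>\<^bsub>M\<^esub> ?g c) = b \<otimes>\<^bsub>N\<^esub> c"
      using hom_mult[OF h mem[OF b] mem[OF c]] b c bij by (simp add: bij_betw_inv_into_right)
    then show "?g (b \<otimes>\<^bsub>N\<^esub> c) = ?g b \<otimes>\<^bsub>M\<^esub> ?g c"
      using bij_betw_inv_into_left[OF bij M.m_closed[OF mem[OF b] mem[OF c]]] by simp
  qed
  then show ?thesis using bij' by (simp add: iso_def)
qed

lemma iso_image_Units_subset:
  assumes "monoid M" "monoid N" "h \<in> iso M N"
  shows "h ` Units M \<subseteq> Units N"
proof
  fix b assume "b \<in> h ` Units M"
  then obtain a where b: "b = h a" and a: "a \<in> Units M" by blast
  have h: "h \<in> hom M N" using assms(3) by (simp add: iso_def)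
  obtain c where c: "c \<in> carrier M" "c \<otimes>\<^bsub>M\<^esub> a = \<one>\<^bsub>M\<^esub>" "a \<otimes>\<^bsub>M\<^esub> c = \<one>\<^bsub>M\<^esub>"
    and a': "a \<in> carrier M"
    using a by (auto simp: Units_def)
  have "h c \<otimes>\<^bsub>N\<^esub> h a = \<one>\<^bsub>N\<^esub>" "h a \<otimes>\<^bsub>N\<^esub> h c = \<one>\<^bsub>N\<^esub>"
    using hom_mult[OF h c(1) a'] hom_mult[OF h a' c(1)] c iso_preserves_one[OF assms] by simp_all
  then show "b \<in> Units N"
    using hom_in_carrier[OF h] a' c(1) by (auto simp: b Units_def)
qed

lemma is_iso_units_of:
  assumes "monoid M" "monoid N" "M \<cong> N"
  shows "units_of M \<cong> units_of N"
proof -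
  obtain h where h: "h \<in> iso M N" using assms(3) by (auto simp: is_iso_def)
  have bij: "bij_betw h (carrier M) (carrier N)" using h by (simp add: iso_def)
  have UM: "Units M \<subseteq> carrier M" and UN: "Units N \<subseteq> carrier N" by (auto simp: Units_def)
  have sub: "h ` Units M \<subseteq> Units N" by (rule iso_image_Units_subset[OF assms(1,2) h])
  have "Units N \<subseteq> h ` Units M"
  proof
    fix b assume b: "b \<in> Units N"
    have "h (inv_into (carrier M) h b) = b"
      using bij_betw_inv_into_right[OF bij] b UN by blast
    moreover have "inv_into (carrier M) h b \<in> Units M"
      using iso_image_Units_subset[OF assms(2,1) monoid_iso_inv_into[OF assms(1) h]] b by blast
    ultimately show "b \<in> h ` Units M" by (metis imageI)
  qed
  then have "bij_betw h (Units M) (Units N)"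
    using sub bij UM by (auto simp: bij_betw_def intro: inj_on_subset)
  moreover have "h \<in> hom (units_of M) (units_of N)"
  proof (rule homI)
    show "h a \<in> carrier (units_of N)" if "a \<in> carrier (units_of M)" for a
      using sub that by (auto simp: units_of_carrier)
    have "h \<in> hom M N" using h by (simp add: iso_def)
    then show "h (a \<otimes>\<^bsub>units_of M\<^esub> b) = h a \<otimes>\<^bsub>units_of N\<^esub> h b"
      if "a \<in> carrier (units_of M)" "b \<in> carrier (units_of M)" for a b
      using hom_mult[of h M N a b] UM that by (auto simp: units_of_carrier units_of_mult)
  qed
  ultimately have "h \<in> iso (units_of M) (units_of N)"
    by (simp add: iso_def units_of_carrier)
  then show ?thesis by (auto simp: is_iso_def)
qed

lemma infinite_int_vec: "infinite (UNIV :: (int ^ 'd::finite) set)"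
proof
  assume "finite (UNIV :: (int ^ 'd) set)"
  moreover have "inj (vec :: int \<Rightarrow> int ^ 'd)" by (simp add: inj_def vec_eq_iff)
  ultimately show False
    using finite_imageD[of "vec :: int \<Rightarrow> int ^ 'd" UNIV] infinite_UNIV_int
    by (meson finite_subset subset_UNIV)
qed

text \<open>If the outputs of \<open>G\<close> and \<open>H\<close> are \<open>y\<close> and \<open>z\<close> with moves \<open>u\<close> and \<open>w\<close>, then agreement of the
  tape machines says \<open>y (a + u) = z (a + w)\<close> for all cells \<open>a\<close>. When \<open>a + u\<close> and \<open>a + w\<close> lie outside
  both windows, this is a condition on the input alone. If \<open>u \<noteq> w\<close>, some input that looks the same
  inside the windows, and so leads to the same moves, violates it.\<close>

lemma tape_lift_determines_step:
  fixes G H :: "('d::finite) rule"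
  assumes G: "is_local n k F G" and H: "is_local n k F' H" and n: "2 \<le> n"
    and eq: "\<And>z. z \<in> tape_space n k \<Longrightarrow> tape_lift G z = tape_lift H z"
    and x: "x \<in> configs n" and q: "q \<in> {1..k}"
  shows "G (x, q) = H (x, q)"
proof -
  have lift: "r = r' \<and> (\<forall>a. y (a + u) = z (a + w))"
    if "G (x, q) = (y, r, u)" "H (x, q) = (z, r', w)" "x \<in> configs n" for x y z r r' u w
    using eq[of "(x, q)"] that q
    by (simp add: tape_space_def tape_lift_def) (simp add: shift_def fun_eq_iff)
  obtain y r u where g: "G (x, q) = (y, r, u)" by (metis surj_pair)
  obtain z r' w where h: "H (x, q) = (z, r', w)" by (metis surj_pair)
  have "u = w"
  proof (rule ccontr)
    assume "u \<noteq> w"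
    define E where "E = F \<union> F'"
    have "finite E" using G H by (simp add: E_def is_local_def)
    then have "finite ((\<lambda>a. a - u) ` E \<union> (\<lambda>a. a - w) ` E)" by simp
    then obtain a where "a \<notin> (\<lambda>a. a - u) ` E \<union> (\<lambda>a. a - w) ` E"
      using ex_new_if_finite[OF infinite_int_vec] by blast
    then have a: "a + u \<notin> E" "a + w \<notin> E"
      by (metis UnCI add_diff_cancel imageI)+
    \<comment> \<open>The new symbol at \<open>a + u\<close> differs from the symbol at \<open>a + w\<close>, where \<open>x'\<close> equals \<open>x\<close>.\<close>
    define x' where "x' = x(a + u := if x (a + w) = 0 then 1 else 0)"
    have x': "x' \<in> configs n" using x n by (auto simp: x'_def configs_def)
    have diff: "x' (a + u) \<noteq> x' (a + w)" using \<open>u \<noteq> w\<close> by (simp add: x'_def)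
    have same: "x b = x' b" if "b \<in> E" for b using a that by (auto simp: x'_def)
    obtain y' s u' where g': "G (x', q) = (y', s, u')" by (metis surj_pair)
    obtain z' s' w' where h': "H (x', q) = (z', s', w')" by (metis surj_pair)
    have "u = u'" by (rule is_local_cong(2)[OF G x x' q _ g g']) (simp add: same E_def)
    moreover have "w = w'" by (rule is_local_cong(2)[OF H x x' q _ h h']) (simp add: same E_def)
    ultimately have "y' (a + u) = z' (a + w)" using lift[OF g' h' x'] by simp
    moreover have "y' (a + u) = x' (a + u)"
      using is_localD(3)[OF G x' q g'] a by (simp add: E_def)
    moreover have "z' (a + w) = x' (a + w)"
      using is_localD(3)[OF H x' q h'] a by (simp add: E_def)
    ultimately show False using diff by simp
  qed
  moreover have "y b = z b" for b
    using lift[OF g h x] \<open>u = w\<close> by (metis diff_add_cancel)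
  ultimately show ?thesis using lift[OF g h x] g h by auto
qed

text \<open>Starting with the head at \<open>0\<close>, the final head position is the move, and translating it back
  to \<open>0\<close> puts the tape where the moving tape machine puts it.\<close>

definition tape_of :: "nat \<Rightarrow> nat \<Rightarrow>
    (('d::finite) config \<times> nat \<times> (int ^ 'd) \<Rightarrow> 'd config \<times> nat \<times> (int ^ 'd)) \<Rightarrow>
    'd config \<times> nat \<Rightarrow> 'd config \<times> nat" where
  "tape_of n k T = (\<lambda>(x, q)\<in>tape_space n k. let (y, q', u) = T (x, q, 0) in (shift (- u) y, q'))"

lemma tape_of_head_lift:
  "tape_of n k (restrict (head_lift G) (head_space n k)) = restrict (tape_lift G) (tape_space n k)"
  unfolding tape_of_def
  by (rule restrict_ext)
    (auto simp: tape_space_def head_space_def head_lift_def tape_lift_def split: prod.splits)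

lemma tape_of_iso:
  assumes n: "2 \<le> n"
  shows "tape_of n k \<in> iso (TM TYPE('d::finite) n k) (TM_fix TYPE('d) n k)"
proof -
  let ?M = "TM TYPE('d) n k" and ?N = "TM_fix TYPE('d) n k"
  let ?S = "head_space n k :: ('d config \<times> nat \<times> (int ^ 'd)) set"
  let ?R = "tape_space n k :: ('d config \<times> nat) set"
  have "0 < n" using n by simp
  note M = carrier_TM[OF this, where 'd='d and k=k]
  note N = carrier_TM_fix[OF \<open>0 < n\<close>, where 'd='d and k=k]
  have surj: "tape_of n k ` carrier ?M = carrier ?N"
    unfolding M N by (force simp: tape_of_head_lift image_iff)
  have inj: "inj_on (tape_of n k) (carrier ?M)"
  proof (rule inj_onI)
    fix S T assume "S \<in> carrier ?M" "T \<in> carrier ?M" and e: "tape_of n k S = tape_of n k T"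
    then obtain G F H F' where G: "S = restrict (head_lift G) ?S" "is_local n k F G"
      and H: "T = restrict (head_lift H) ?S" "is_local n k F' H"
      unfolding M by blast
    have "tape_lift G z = tape_lift H z" if "z \<in> ?R" for z
      using fun_cong[OF e[unfolded G(1) H(1) tape_of_head_lift], of z] that by simp
    note step = tape_lift_determines_step[OF G(2) H(2) n this]
    show "S = T"
      unfolding G(1) H(1)
      by (rule restrict_ext) (auto simp: head_space_def head_lift_def step)
  qed
  have "tape_of n k \<in> hom ?M ?N"
  proof (rule homI)
    show "tape_of n k T \<in> carrier ?N" if "T \<in> carrier ?M" for T using surj that by blast
    fix S T assume "S \<in> carrier ?M" "T \<in> carrier ?M"
    then obtain G F H F' where G: "S = restrict (head_lift G) ?S" "is_local n k F G"
      and H: "T = restrict (head_lift H) ?S" "is_local n k F' H"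
      unfolding M by blast
    have "compose ?S S T = restrict (head_lift (step_comp G H)) ?S"
      unfolding compose_def
      by (rule restrict_ext) (simp add: G H head_lift_in[OF H(2)] head_lift_comp)
    moreover have "compose ?R (restrict (tape_lift G) ?R) (restrict (tape_lift H) ?R)
        = restrict (tape_lift (step_comp G H)) ?R"
      unfolding compose_def
      by (rule restrict_ext) (simp add: tape_lift_in[OF H(2)] tape_lift_comp)
    ultimately show "tape_of n k (S \<otimes>\<^bsub>?M\<^esub> T) = tape_of n k S \<otimes>\<^bsub>?N\<^esub> tape_of n k T"
      unfolding G(1) H(1) tape_of_head_lift by (simp add: TM_def TM_fix_def tape_of_head_lift)
  qed
  then show ?thesis using surj inj by (simp add: iso_def bij_betw_def)
qed

theorem corollary2p17:
  fixes n k :: nat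
  assumes "n \<ge> 2" and "k \<ge> 1"
  shows "TM_fix TYPE('d::finite) n k \<cong> TM TYPE('d) n k \<and>
         RTM_fix TYPE('d) n k \<cong> RTM TYPE('d) n k"
proof -
  have n: "0 < n" using assms(1) by simp
  have iso: "TM_fix TYPE('d) n k \<cong> TM TYPE('d) n k"
    using monoid_iso_inv_into[OF monoid_TM[OF n] tape_of_iso[OF assms(1)]]
    by (auto simp: is_iso_def)
  then show ?thesis
    using is_iso_units_of[OF monoid_TM_fix[OF n] monoid_TM[OF n] iso]
    by (simp add: RTM_def RTM_fix_def)
qed

end
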